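(* Every dual L\"obell graph of degree $n\geq 5$ has a legal system.
   Context: The $n$-antiprism is the polyhedron whose boundary consists of two disjoint $n$-gon faces joined by an annulus that is subdivided into $2n$ triangles, so that there is one $n$-gon and three triangles at each vertex. The dual L\"obell graph of degree $n\geq 4$ is the $1$-skeleton of the polyhedron obtained from an $n$-antiprism by centrally subdividing each $n$-gon into $n$ triangles (i.e. adding, for each of the two $n$-gons, a new vertex joined to all $n$ vertices of that $n$-gon). For $n=5$ it is the $1$-skeleton of the icosahedron. Let $\Gamma=\Gamma(V,E)$ be a simplicial graph. A state is a subset $S\subset V$; it is legal if the subgraphs of $\Gamma$ induced by $S$ and by $V-S$ are both nonempty and connected. A move at $v\in V$ is a subset $m_v\subset V$ with $v\in m_v$ and $u\notin m_v$ whenever $\{u,v\}\in E$. A system of moves is a choice of a move $m_v$ for each $v\in V$ (the $m_v$ need not be distinct). Identify $2^V$ with the group $\mathbb{Z}_2^V$ (multiplication is symmetric difference), and let $M\le\mathbb{Z}_2^V$ be the subgroup generated by the moves; $M$ acts on the set of states by symmetric difference. The system is legal if there is an $M$-orbit all of whose elements are legal states; $\Gamma$ has a legal system if some system of moves for $\Gamma$ is legal. *)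

theory Defs
  imports
    "HOL-Algebra.Generated_Groups"
    "HOL-Algebra.Group_Action"
    "Graph_Theory.Digraph_Component"
begin

text \<open>
  A simplicial graph is a symmetric loop-free digraph whose arcs are ordered pairs of vertices
  (for finite graphs: locale \<^locale>\<open>pair_graph\<close>). Names such as \<open>connected\<close> and \<open>orbits\<close> are
  qualified because other library theories define constants with the same base name.
\<close>

definition is_state :: "'a pair_pre_digraph \<Rightarrow> 'a set \<Rightarrow> bool" where
  "is_state G S \<longleftrightarrow> S \<subseteq> pverts G"

definition legal_state :: "'a pair_pre_digraph \<Rightarrow> 'a set \<Rightarrow> bool" where
  "legal_state G S \<longleftrightarrow> is_state G S \<and>
     S \<noteq> {} \<and> Digraph_Component.connected (with_proj G \<restriction> S) \<and>
     pverts G - S \<noteq> {} \<and> Digraph_Component.connected (with_proj G \<restriction> (pverts G - S))"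

definition is_move :: "'a pair_pre_digraph \<Rightarrow> 'a \<Rightarrow> 'a set \<Rightarrow> bool" where
  "is_move G v m \<longleftrightarrow> m \<subseteq> pverts G \<and> v \<in> m \<and> (\<forall>u. (u, v) \<in> parcs G \<longrightarrow> u \<notin> m)"

text \<open>Only the values of \<open>m\<close> on the vertices of \<open>G\<close> matter.\<close>

definition system_of_moves :: "'a pair_pre_digraph \<Rightarrow> ('a \<Rightarrow> 'a set) \<Rightarrow> bool" where
  "system_of_moves G m \<longleftrightarrow> (\<forall>v\<in>pverts G. is_move G v (m v))"

text \<open>The group \<open>\<int>\<^sub>2\<^sup>V\<close>, with its elements written as subsets of \<open>V\<close>.\<close>

definition powerset_group :: "'a set \<Rightarrow> 'a set monoid" where
  "powerset_group V = \<lparr>carrier = Pow V, monoid.mult = (\<lambda>A B. sym_diff A B), one = {}\<rparr>"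

lemma comm_group_powerset_group: "comm_group (powerset_group V)"
proof (rule comm_groupI)
  fix x assume "x \<in> carrier (powerset_group V)"
  then show "\<exists>y\<in>carrier (powerset_group V). y \<otimes>\<^bsub>powerset_group V\<^esub> x = \<one>\<^bsub>powerset_group V\<^esub>"
    by (intro bexI[of _ x]) (auto simp: powerset_group_def)
qed (auto simp: powerset_group_def)

definition moves_group :: "'a pair_pre_digraph \<Rightarrow> ('a \<Rightarrow> 'a set) \<Rightarrow> 'a set monoid" where
  "moves_group G m = subgroup_generated (powerset_group (pverts G)) (m ` pverts G)"

definition legal_system :: "'a pair_pre_digraph \<Rightarrow> ('a \<Rightarrow> 'a set) \<Rightarrow> bool" where
  "legal_system G m \<longleftrightarrow> system_of_moves G m \<and>
     (\<exists>X \<in> Group_Action.orbits (moves_group G m) {S. is_state G S} (\<lambda>g S. sym_diff g S).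
        \<forall>S\<in>X. legal_state G S)"

definition has_legal_system :: "'a pair_pre_digraph \<Rightarrow> bool" where
  "has_legal_system G \<longleftrightarrow> (\<exists>m. legal_system G m)"

text \<open>
  \<open>Ring b 0, \<dots>, Ring b (n - 1)\<close> are the vertices, in cyclic order, of one of the two \<open>n\<close>-gons of
  the \<open>n\<close>-antiprism (one for each value of \<open>b\<close>), and \<open>Apex b\<close> is the vertex added in its centre.
\<close>

datatype loebell_vertex = Apex bool | Ring bool nat

definition antiprism_triangles :: "nat \<Rightarrow> loebell_vertex set set" where
  "antiprism_triangles n =
     (\<lambda>i. {Ring False i, Ring False (Suc i mod n), Ring True i}) ` {..<n} \<union>
     (\<lambda>i. {Ring True i, Ring True (Suc i mod n), Ring False (Suc i mod n)}) ` {..<n}"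

definition cone_triangles :: "nat \<Rightarrow> bool \<Rightarrow> loebell_vertex set set" where
  "cone_triangles n b = (\<lambda>i. {Apex b, Ring b i, Ring b (Suc i mod n)}) ` {..<n}"

text \<open>
  The subdivided antiprism has only triangular faces, so two vertices are joined by an edge
  of the polyhedron iff they are distinct and lie in a common face.
\<close>

definition dual_loebell_faces :: "nat \<Rightarrow> loebell_vertex set set" where
  "dual_loebell_faces n = antiprism_triangles n \<union> cone_triangles n False \<union> cone_triangles n True"

definition dual_loebell_graph :: "nat \<Rightarrow> loebell_vertex pair_pre_digraph" where
  "dual_loebell_graph n =
     \<lparr>pverts = \<Union>(dual_loebell_faces n),
      parcs = {(u, v). u \<noteq> v \<and> (\<exists>F\<in>dual_loebell_faces n. u \<in> F \<and> v \<in> F)}\<rparr>"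

lemma pverts_dual_loebell_graph:
  assumes "n \<ge> 1"
  shows "pverts (dual_loebell_graph n) = range Apex \<union> {Ring b i | b i. i < n}"
proof
  show "pverts (dual_loebell_graph n) \<subseteq> range Apex \<union> {Ring b i | b i. i < n}"
    by (auto simp: dual_loebell_graph_def dual_loebell_faces_def antiprism_triangles_def
        cone_triangles_def)
  have "Apex b \<in> \<Union>(cone_triangles n b)" for b
    using assms by (auto simp: cone_triangles_def lessThan_empty_iff)
  moreover have "Ring b i \<in> \<Union>(cone_triangles n b)" if "i < n" for b i
    using that by (auto simp: cone_triangles_def)
  moreover have "\<Union>(cone_triangles n b) \<subseteq> pverts (dual_loebell_graph n)" for b
    by (cases b) (auto simp: dual_loebell_graph_def dual_loebell_faces_def)
  ultimately show "range Apex \<union> {Ring b i | b i. i < n} \<subseteq> pverts (dual_loebell_graph n)"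
    by blast
qed

lemma parcs_dual_loebell_graph:
  assumes "n \<ge> 2"
  shows "parcs (dual_loebell_graph n) = symcl (
     {(Ring b i, Ring b (Suc i mod n)) | b i. i < n} \<union>
     {(Ring False i, Ring True i) | i. i < n} \<union>
     {(Ring False (Suc i mod n), Ring True i) | i. i < n} \<union>
     {(Apex b, Ring b i) | b i. i < n})" (is "_ = symcl ?R")
proof -
  define R where "R = ?R"
  have mod: "Suc i mod n \<noteq> i" "i \<noteq> Suc i mod n" if "i < n" for i
    using assms that by (auto simp: mod_Suc)
  have lt: "Suc i mod n < n" for i using assms by simp
  let ?E = "parcs (dual_loebell_graph n)"
  let ?A = "\<lambda>i. {Ring False i, Ring False (Suc i mod n), Ring True i}"
  let ?B = "\<lambda>i. {Ring True i, Ring True (Suc i mod n), Ring False (Suc i mod n)}"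
  let ?C = "\<lambda>b i. {Apex b, Ring b i, Ring b (Suc i mod n)}"
  have faces: "F \<in> dual_loebell_faces n \<longleftrightarrow> (\<exists>i<n. F = ?A i \<or> F = ?B i \<or> (\<exists>b. F = ?C b i))" for F
    unfolding dual_loebell_faces_def antiprism_triangles_def cone_triangles_def ex_bool_eq
    by blast
  have R1: "(Ring b i, Ring b (Suc i mod n)) \<in> R" "(Ring False i, Ring True i) \<in> R"
    "(Ring False (Suc i mod n), Ring True i) \<in> R" "(Apex b, Ring b i) \<in> R" if "i < n" for b i
    unfolding R_def using that by blast+
  have "(u, v) \<in> R \<or> (v, u) \<in> R" if uv: "(u, v) \<in> ?E" for u v
  proof -
    obtain F where F: "F \<in> dual_loebell_faces n" "u \<in> F" "v \<in> F" "u \<noteq> v"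
      using uv by (auto simp: dual_loebell_graph_def)
    then obtain i where i: "i < n" "F = ?A i \<or> F = ?B i \<or> (\<exists>b. F = ?C b i)"
      unfolding faces by blast
    note r = R1[OF i(1)] R1(2,4)[OF lt[of i]]
    from i(2) show ?thesis
    proof (elim disjE exE)
      assume "F = ?A i" with F(2-4) r show ?thesis by fastforce
    next
      assume "F = ?B i" with F(2-4) r show ?thesis by fastforce
    next
      fix b assume "F = ?C b i" with F(2-4) r show ?thesis by fastforce
    qed
  qed
  then have "?E \<subseteq> symcl R"
    by (force simp: symcl_def)
  moreover have E: "(u, v) \<in> ?E \<and> (v, u) \<in> ?E"
    if "F \<in> dual_loebell_faces n" "u \<in> F" "v \<in> F" "u \<noteq> v" for F u v
    using that by (auto simp: dual_loebell_graph_def)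
  have "(u, v) \<in> ?E \<and> (v, u) \<in> ?E" if "(u, v) \<in> R" for u v
  proof -
    have f: "?A i \<in> dual_loebell_faces n" "?B i \<in> dual_loebell_faces n"
      "?C b i \<in> dual_loebell_faces n" if "i < n" for i b
      unfolding faces using that by blast+
    from that show ?thesis unfolding R_def
    proof (elim UnE CollectE exE conjE)
      fix b i assume "(u, v) = (Ring b i, Ring b (Suc i mod n))" "i < n"
      then show ?thesis using E[OF f(3)[of i b]] mod(2)[of i] by simp
    next
      fix i assume "(u, v) = (Ring False i, Ring True i)" "i < n"
      then show ?thesis using E[OF f(1)[of i]] by simp
    next
      fix i assume "(u, v) = (Ring False (Suc i mod n), Ring True i)" "i < n"
      then show ?thesis using E[OF f(1)[of i]] by simp
    next
      fix b i assume "(u, v) = (Apex b, Ring b i)" "i < n"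
      then show ?thesis using E[OF f(3)[of i b]] by simp
    qed
  qed
  then have "symcl R \<subseteq> ?E"
    by (auto simp: symcl_def)
  ultimately show ?thesis
    unfolding R_def by (rule subset_antisym)
qed

lemma pair_graph_dual_loebell_graph: "pair_graph (dual_loebell_graph n)"
proof -
  have fin: "finite (pverts (dual_loebell_graph n))"
    by (auto simp: dual_loebell_graph_def dual_loebell_faces_def antiprism_triangles_def
        cone_triangles_def)
  have sub: "parcs (dual_loebell_graph n) \<subseteq> pverts (dual_loebell_graph n) \<times> pverts (dual_loebell_graph n)"
    by (auto simp: dual_loebell_graph_def)
  have "finite (parcs (dual_loebell_graph n))"
    using finite_subset[OF sub] fin by simp
  moreover have "symmetric (with_proj (dual_loebell_graph n))"
    by (auto simp: symmetric_def sym_def dual_loebell_graph_def)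
  moreover have "fst e \<noteq> snd e" if "e \<in> parcs (dual_loebell_graph n)" for e
    using that by (auto simp: dual_loebell_graph_def)
  ultimately show ?thesis
    using fin sub by unfold_locales auto
qed

end

theory Submission
  imports Defs
begin

text \<open>
  The proof restricts attention to states in which the two apices differ and to systems of moves
  that keep them different: the move at both apices is the pair of apices, and the moves at the
  other vertices contain no apex. The remaining \<open>2 * n\<close> vertices are traversed in a zigzag,
  alternating between the two \<open>n\<close>-gons; they form a cycle in which every vertex is adjacent to
  the vertices one and two steps away, and those of each parity are adjacent to one apex. Such a
  state is recorded by the cyclic word whose letter at a vertex tells whether this vertex is in the
  same state as its own apex.

  A vertex with letter \<open>True\<close> is connected to its apex inside its part. A vertex with letter
  \<open>False\<close> can walk in steps of two inside its run of letters \<open>False\<close>; such steps keep the parity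
  and hence stay in the same part. It reaches its part's apex if one end of the run is at odd
  distance: the \<open>True\<close> there has the opposite parity and therefore the same state. If the run
  has length 1 or an even length, then every vertex of the run is at odd distance from one of the
  two ends. So a state is legal if its word satisfies \<open>runs_ok\<close>
  (lemma \<open>legal_word_state\<close>).

  Moves act on words by flipping letters: a move at a vertex of the cycle flips this letter and no
  letter one or two steps away, and the move at an apex flips all letters. It remains to find, for
  each \<open>n\<close>, a finite set of cyclic words of length \<open>2 * n\<close> with legal runs that is closed under
  enough flips (\<open>legal_words\<close>). From such a set for \<open>n\<close> one gets a set for \<open>n + 3\<close>
  by repeating the first three letters of each word twice more
  (lemma \<open>legal_words_triple_head\<close>): a run that contains all three letters becomes longer by the
  even number 6, and if the three letters are not equal, the only additional runs have length 1
  or 2. This leaves \<open>n = 5, 6, 7\<close>. For \<open>n = 6\<close> and \<open>n = 7\<close> the moves are the colour classes of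
  a proper colouring of the cycle and its chords with three and four colours. For the icosahedron,
  \<open>n = 5\<close>, some of the moves contain adjacent vertices.
\<close>

section \<open>Orbits of states and connected induced subgraphs\<close>

text \<open>
  It suffices that a family of legal states is invariant under the single moves; no orbit has to be
  computed exactly.
\<close>

lemma legal_systemI:
  assumes moves: "system_of_moves G m"
    and S: "S \<in> \<F>"
    and legal: "\<And>S. S \<in> \<F> \<Longrightarrow> legal_state G S"
    and closed: "\<And>v S. v \<in> pverts G \<Longrightarrow> S \<in> \<F> \<Longrightarrow> sym_diff (m v) S \<in> \<F>"
  shows "legal_system G m"
proof -
  define P where "P = powerset_group (pverts G)"
  interpret P: comm_group P
    unfolding P_def by (rule comm_group_powerset_group)
  have inv: "inv\<^bsub>P\<^esub> h = h" if "h \<in> carrier P" for h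
    using that by (intro P.inv_equality) (auto simp: P_def powerset_group_def)
  have gen: "sym_diff g T \<in> \<F>"
    if "g \<in> generate P (carrier P \<inter> m ` pverts G)" "T \<in> \<F>" for g T
    using that
  proof (induction g arbitrary: T rule: generate.induct)
    case one
    then show ?case by (simp add: P_def powerset_group_def)
  next
    case (incl h)
    then show ?case using closed by auto
  next
    case (inv h)
    then show ?case using closed \<open>\<And>h. h \<in> carrier P \<Longrightarrow> inv\<^bsub>P\<^esub> h = h\<close> by auto
  next
    case (eng g h)
    have "sym_diff (g \<otimes>\<^bsub>P\<^esub> h) T = sym_diff g (sym_diff h T)"
      by (auto simp: P_def powerset_group_def)
    then show ?case using eng by simp
  qed
  have "S \<in> {S. is_state G S}"
    using legal[OF S] by (simp add: legal_state_def)
  moreover have "legal_state G T"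
    if "T \<in> orbit (moves_group G m) (\<lambda>g S. sym_diff g S) S" for T
    using that gen[OF _ S] legal
    by (auto simp: orbit_def moves_group_def subgroup_generated_def P_def)
  ultimately show ?thesis
    unfolding legal_system_def using moves by (auto simp: orbits_def)
qed

lemma connected_if_all_reach:
  assumes "h \<in> S" and "\<And>v. v \<in> S \<Longrightarrow> (v, h) \<in> (Restr (parcs G) S)\<^sup>*"
  shows "Digraph_Component.connected (with_proj G \<restriction> S)"
proof -
  let ?R = "symcl (arcs_ends (with_proj G \<restriction> S))"
  have ends: "arcs_ends (with_proj G \<restriction> S) = Restr (parcs G) S"
    by (auto simp: arcs_ends_def arc_to_ends_def induce_subgraph_def with_proj_def image_iff)
  have "sym ?R"
    by (auto simp: sym_def symcl_def)
  have to: "(v, h) \<in> ?R\<^sup>*" if "v \<in> S" for v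
  proof -
    have "(v, h) \<in> (Restr (parcs G) S)\<^sup>*" by (rule assms(2)[OF that])
    also have "\<dots> \<subseteq> ?R\<^sup>*" unfolding ends by (rule rtrancl_mono) (auto simp: symcl_def)
    finally show ?thesis .
  qed
  have "(u, v) \<in> ?R\<^sup>*" if "u \<in> S" "v \<in> S" for u v
    using to[OF that(1)] symD[OF sym_rtrancl[OF \<open>sym ?R\<close>] to[OF that(2)]] by (rule rtrancl_trans)
  moreover have "?R \<subseteq> S \<times> S" unfolding ends by (auto simp: symcl_def)
  ultimately have "(u, v) \<in> rtrancl_on S ?R" if "u \<in> S" "v \<in> S" for u v
    using that by (intro rtrancl_consistent_rtrancl_on) auto
  then show ?thesis
    unfolding connected_conv using assms(1) by auto
qed

section \<open>Cyclic words\<close>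

definition cyc :: "bool list \<Rightarrow> nat \<Rightarrow> bool" where
  "cyc x i \<longleftrightarrow> x ! (i mod length x)"

text \<open>
  Only maximal blocks of \<open>False\<close> between two letters \<open>True\<close> of the list are tested; a block at
  either end of the list passes. Applied to \<open>x @ x\<close>, this tests every run of the cyclic word
  \<open>x\<close>, those across the end included.
\<close>

fun gaps_ok :: "bool list \<Rightarrow> bool" where
  "gaps_ok [] \<longleftrightarrow> True"
| "gaps_ok (b # x) \<longleftrightarrow> gaps_ok x \<and>
     (b \<longrightarrow> (let m = length (takeWhile Not x) in m = length x \<or> m = 1 \<or> even m))"

definition runs_ok :: "bool list \<Rightarrow> bool" where
  "runs_ok x \<longleftrightarrow> True \<in> set x \<and> gaps_ok (x @ x)"

lemma gaps_okD:
  assumes "gaps_ok x" "Suc (i + m) < length x" "x ! i" "x ! Suc (i + m)"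
    and "\<And>t. 1 \<le> t \<Longrightarrow> t \<le> m \<Longrightarrow> \<not> x ! (i + t)"
  shows "m = 1 \<or> even m"
  using assms
proof (induction x arbitrary: i)
  case (Cons b x)
  show ?case
  proof (cases i)
    case 0
    have m: "m < length x" "x ! m" using Cons.prems 0 by simp_all
    have "\<not> x ! t" if "t < m" for t using Cons.prems(5)[of "Suc t"] that 0 by simp
    then have "\<forall>c \<in> set (take m x). \<not> c" by (auto simp: in_set_conv_nth)
    then have "takeWhile Not (take m x @ True # drop (Suc m) x) = take m x"
      by (subst takeWhile_append2) auto
    moreover have "take m x @ True # drop (Suc m) x = x"
      using id_take_nth_drop[OF m(1)] m(2) by simp
    ultimately have "takeWhile Not x = take m x" by simp
    then have "length (takeWhile Not x) = m" using m by simp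
    then show ?thesis using Cons.prems 0 m by (auto simp: Let_def)
  next
    case (Suc i')
    then show ?thesis using Cons.prems by (intro Cons.IH[of i']) auto
  qed
qed simp

text \<open>
  If \<open>u\<close> is constantly \<open>False\<close>, the run around it grows by 6, which keeps even lengths even and
  turns no good length into a bad one since the run has length at least 3. Otherwise the additional
  runs lie inside \<open>u @ u @ u\<close> and have length at most 2, and the runs that leave the block to the
  left and to the right do not change.
\<close>

lemma gaps_ok_triple:
  assumes "length u = 3" "gaps_ok (p @ u @ q)"
  shows "gaps_ok (p @ u @ u @ u @ q)"
  using assms(2)
proof (induction p)
  case Nil
  obtain a b c where "u = [a, b, c]"
    using assms(1) by (auto simp: length_Suc_conv numeral_3_eq_3)
  then show ?case using Nil
    by (cases a; cases b; cases c) (auto simp: Let_def)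
next
  case (Cons b p)
  show ?case
  proof (cases "True \<in> set (p @ u)")
    case True
    then have "takeWhile Not ((p @ u) @ q') = takeWhile Not (p @ u)" for q'
      by (intro takeWhile_append1[of True]) auto
    from this[of q] this[of "u @ u @ q"] have "takeWhile Not (p @ u @ q) = takeWhile Not (p @ u)"
      "takeWhile Not (p @ u @ u @ u @ q) = takeWhile Not (p @ u)" by simp_all
    moreover have "length (takeWhile Not (p @ u)) < length (p @ u)"
      using True by (metis length_takeWhile_le le_neq_implies_less takeWhile_eq_all_conv
          takeWhile_eq_take take_all_iff order_refl)
    ultimately show ?thesis using Cons by (auto simp: Let_def)
  next
    case False
    then have "takeWhile Not ((p @ u) @ q') = (p @ u) @ takeWhile Not q'" for q'
      by (intro takeWhile_append2) auto
    moreover have "takeWhile Not (u @ q') = u @ takeWhile Not q'" for q'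
      using False by (intro takeWhile_append2) auto
    ultimately have "takeWhile Not (p @ u @ q) = p @ u @ takeWhile Not q"
      "takeWhile Not (p @ u @ u @ u @ q) = p @ u @ u @ u @ takeWhile Not q" by simp_all
    then show ?thesis using Cons assms(1) by (auto simp: Let_def)
  qed
qed

text \<open>
  The relation of being one or two steps apart on a cycle of length \<open>N\<close>, for positions below
  \<open>N\<close>.
\<close>

definition near :: "nat \<Rightarrow> nat \<Rightarrow> nat \<Rightarrow> bool" where
  "near N i j \<longleftrightarrow> i \<noteq> j \<and> (i \<le> j + 2 \<and> j \<le> i + 2 \<or> i + N \<le> j + 2 \<or> j + N \<le> i + 2)"

text \<open>
  The set of positions of \<open>True\<close> in \<open>d\<close> is admissible as a move at position \<open>j\<close>.
\<close>

definition peak :: "bool list \<Rightarrow> nat \<Rightarrow> bool" where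
  "peak d j \<longleftrightarrow> d ! j \<and> (\<forall>i<length d. near (length d) i j \<longrightarrow> \<not> d ! i)"

definition flip :: "bool list \<Rightarrow> bool list \<Rightarrow> bool list" where
  "flip d x = map2 (\<lambda>a b. a \<noteq> b) d x"

text \<open>
  Closure under \<open>map Not\<close> accounts for the move at the apices. It also implies that the runs of
  \<open>True\<close> satisfy the same condition as the runs of \<open>False\<close>.
\<close>

definition legal_words :: "nat \<Rightarrow> bool list set \<Rightarrow> bool" where
  "legal_words n W \<longleftrightarrow> W \<noteq> {} \<and>
     (\<forall>x\<in>W. length x = 2 * n \<and> runs_ok x \<and> map Not x \<in> W) \<and>
     (\<forall>j<2 * n. \<exists>d. length d = 2 * n \<and> peak d j \<and> (\<forall>x\<in>W. flip d x \<in> W))"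

text \<open>
  If the run of \<open>False\<close> containing position \<open>i\<close> has its nearest \<open>True\<close> at distance \<open>l\<close> to the
  left and \<open>r\<close> to the right, its length is \<open>l + r - 1\<close>. When this is even, one of \<open>l\<close> and
  \<open>r\<close> is odd; when it is 1, both are 1. The left end is described by its own position \<open>i'\<close>, which
  avoids subtraction modulo the length.
\<close>

lemma odd_run_end:
  assumes "runs_ok x" "\<not> cyc x i"
  shows "\<exists>r. odd r \<and> (cyc x (i + r) \<and> (\<forall>t<r. \<not> cyc x (i + t)) \<or>
    (\<exists>i'. (i' + r) mod length x = i mod length x \<and> cyc x i' \<and>
       (\<forall>t. 1 \<le> t \<and> t \<le> r \<longrightarrow> \<not> cyc x (i' + t))))"
proof -
  define N where "N = length x"
  obtain k where k: "k < N" "x ! k"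
    using assms(1) by (auto simp: runs_ok_def in_set_conv_nth N_def)
  have N: "N > 0" using k by simp
  define j where "j = i mod N"
  have j: "j < N" "\<not> x ! j" using assms(2) N by (auto simp: cyc_def N_def j_def)
  have "k \<noteq> j" using j k by auto
  define P where "P r \<longleftrightarrow> r > 0 \<and> cyc x (j + r)" for r
  define Q where "Q l \<longleftrightarrow> l > 0 \<and> l \<le> N \<and> cyc x (j + N - l)" for l
  obtain s where s: "s > 0" "s < N" "P s" "Q (N - s)"
  proof (cases "j < k")
    case True
    then show ?thesis using k j by (intro that[of "k - j"]) (auto simp: P_def Q_def cyc_def N_def)
  next
    case False
    with \<open>k \<noteq> j\<close> have "k < j" by simp
    then show ?thesis using k j
      by (intro that[of "k + N - j"]) (auto simp: P_def Q_def cyc_def N_def)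
  qed
  define r where "r = (LEAST r. P r)"
  define l where "l = (LEAST l. Q l)"
  have r: "P r" "r \<le> s" "\<And>t. t < r \<Longrightarrow> \<not> P t"
    unfolding r_def using LeastI[of P, OF s(3)] Least_le[of P, OF s(3)] not_less_Least by auto
  have l: "Q l" "l \<le> N - s" "\<And>t. t < l \<Longrightarrow> \<not> Q t"
    unfolding l_def using LeastI[of Q, OF s(4)] Least_le[of Q, OF s(4)] not_less_Least by auto
  have pos: "r > 0" "l > 0" "l + r \<le> N" using r l s by (auto simp: P_def Q_def)
  \<comment> \<open>The run occupies the \<open>m\<close> positions after \<open>i'\<close>; the summand \<open>N\<close> keeps the natural
    subtraction exact.\<close>
  define i' where "i' = j + N - l"
  define m where "m = l + r - 1"
  have zero_r: "\<not> cyc x (j + t)" if "t < r" for t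
    using r(3)[OF that] j by (cases "t = 0") (auto simp: P_def cyc_def N_def)
  have zero_l: "\<not> cyc x (i' + t)" if "1 \<le> t" "t \<le> l" for t
  proof (cases "t = l")
    case True
    then show ?thesis using j pos l by (auto simp: i'_def cyc_def N_def Q_def)
  next
    case False
    then have "\<not> Q (l - t)" using that by (intro l(3)) simp
    moreover have "j + N - (l - t) = i' + t" using that pos unfolding i'_def by simp
    ultimately show ?thesis using that False pos by (auto simp: Q_def)
  qed
  have zero: "\<not> cyc x (i' + t)" if "1 \<le> t" "t \<le> m" for t
  proof (cases "t \<le> l")
    case True
    then show ?thesis using zero_l that by simp
  next
    case False
    then have "\<not> cyc x (j + (t - l))" using that by (intro zero_r) (simp add: m_def)
    moreover have "i' + t = j + (t - l) + N" using False pos by (simp add: i'_def)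
    ultimately show ?thesis by (simp add: cyc_def N_def)
  qed
  have ends: "cyc x i'" "cyc x (Suc (i' + m))"
  proof -
    show "cyc x i'" using l by (simp add: Q_def i'_def)
    have "Suc (i' + m) = j + r + N" using pos by (simp add: i'_def m_def)
    then show "cyc x (Suc (i' + m))" using r by (simp add: P_def cyc_def N_def)
  qed
  define e where "e = i' mod N"
  have nth: "(x @ x) ! (e + t) = cyc x (i' + t)" if "t \<le> N" for t
  proof -
    have "e < N" using N by (simp add: e_def)
    moreover have "cyc x (i' + t) = cyc x (e + t)" by (simp add: e_def cyc_def N_def mod_add_left_eq)
    ultimately show ?thesis using that
      by (cases "e + t < N") (auto simp: nth_append cyc_def N_def le_mod_geq)
  qed
  have "m = 1 \<or> even m"
  proof (rule gaps_okD)
    show "gaps_ok (x @ x)" using assms(1) by (simp add: runs_ok_def)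
    have "e < N" using N by (simp add: e_def)
    then show "Suc (e + m) < length (x @ x)" using pos by (simp add: m_def N_def)
    show "(x @ x) ! e" using nth[of 0] ends by simp
    show "(x @ x) ! Suc (e + m)" using nth[of "Suc m"] ends pos by (simp add: m_def)
    show "\<not> (x @ x) ! (e + t)" if "1 \<le> t" "t \<le> m" for t
      using nth[of t] zero[OF that] that pos by (simp add: m_def)
  qed
  then have "odd r \<or> odd l" using pos by (auto simp: m_def)
  then show ?thesis
  proof
    assume "odd r"
    moreover have "cyc x (i + t) = cyc x (j + t)" for t
      by (simp add: j_def cyc_def N_def mod_add_left_eq)
    ultimately show ?thesis using r(1) zero_r by (auto simp: P_def)
  next
    assume "odd l"
    moreover have "(i' + l) mod length x = i mod length x"
      using pos unfolding i'_def j_def N_def[symmetric] by simp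
    ultimately show ?thesis using zero_l ends(1) by blast
  qed
qed

section \<open>Lengthening words by six letters\<close>

definition triple_head :: "bool list \<Rightarrow> bool list" where
  "triple_head x = take 3 x @ take 3 x @ x"

lemma runs_ok_triple_head:
  assumes "runs_ok x" "length x \<ge> 3"
  shows "runs_ok (triple_head x)"
proof -
  define u q where "u = take 3 x" and "q = drop 3 x"
  have x: "x = u @ q" and u: "length u = 3" using assms(2) by (auto simp: u_def q_def)
  have t: "triple_head x = u @ u @ u @ q" unfolding triple_head_def u_def[symmetric] by (simp add: x)
  have "gaps_ok ([] @ u @ q @ u @ q)" using assms(1) by (simp add: runs_ok_def x)
  then have "gaps_ok ((u @ u @ u @ q) @ u @ q)" using gaps_ok_triple[OF u, of "[]"] by simp
  then have "gaps_ok ((u @ u @ u @ q) @ u @ u @ u @ q)" by (rule gaps_ok_triple[OF u])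
  moreover have "True \<in> set (triple_head x)" using assms(1) by (auto simp: runs_ok_def triple_head_def)
  ultimately show ?thesis by (simp add: runs_ok_def t)
qed

lemma nth_triple_head:
  assumes "length x \<ge> 3" "i < length x + 6"
  shows "triple_head x ! i = x ! (if i < 6 then i mod 3 else i - 6)"
proof -
  consider "i < 3" | "3 \<le> i" "i < 6" | "6 \<le> i" by linarith
  then show ?thesis using assms
    by cases (simp_all add: triple_head_def nth_append min_def le_mod_geq)
qed

lemma length_triple_head [simp]: "length x \<ge> 3 \<Longrightarrow> length (triple_head x) = length x + 6"
  by (simp add: triple_head_def)

text \<open>
  The map \<open>f\<close> in the proof sends each position of the longer word to the position of \<open>d\<close> from
  which its letter is copied. Three successive positions of the repeated block are copied from
  three different positions, so \<open>f\<close> maps nearby positions to nearby, distinct positions, and a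
  peak of \<open>d\<close> at \<open>f j\<close> gives a peak at \<open>j\<close>.
\<close>

lemma peak_triple_head:
  assumes "length d \<ge> 5" "j < length d + 6" "peak d (if j < 6 then j mod 3 else j - 6)"
  shows "peak (triple_head d) j"
proof -
  define N where "N = length d"
  define f where "f i = (if i < 6 then i mod 3 else i - 6)" for i :: nat
  have nth: "triple_head d ! i = d ! f i" if "i < N + 6" for i
    using that assms(1) by (simp add: nth_triple_head f_def N_def)
  have f: "f i < N" if "i < N + 6" for i
    using that assms(1) by (auto simp: f_def N_def intro: less_le_trans[of _ 3])
  have near: "near N (f i) (f j)" if "i < N + 6" "near (N + 6) i j" for i
  proof -
    have N: "5 \<le> N" "j < N + 6" using assms(1,2) by (auto simp: N_def)
    have "(k = f k \<or> k = f k + 3) \<and> f k < 3 \<or> k = f k + 6" for k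
    proof -
      have "k < 3 \<or> 3 \<le> k \<and> k < 6 \<or> 6 \<le> k" by linarith
      then show ?thesis by (auto simp: f_def le_mod_geq)
    qed
    from this[of i] this[of j] show ?thesis
      using N that unfolding near_def by linarith
  qed
  have pk: "peak d (f j)" using assms(3) by (simp only: f_def)
  have j: "j < N + 6" using assms(2) by (simp add: N_def)
  have len: "length (triple_head d) = N + 6" using assms(1) by (simp add: N_def)
  show ?thesis
    unfolding peak_def len
  proof (intro conjI allI impI)
    show "triple_head d ! j" using pk nth[OF j] by (simp add: peak_def)
    fix i assume i: "i < N + 6" "near (N + 6) i j"
    then have "\<not> d ! f i" using pk f[OF i(1)] near[OF i] by (simp add: peak_def N_def)
    then show "\<not> triple_head d ! i" using nth[OF i(1)] by simp
  qed
qed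

lemma legal_words_triple_head:
  assumes "legal_words n W" "n \<ge> 3"
  shows "legal_words (n + 3) (triple_head ` W)"
  unfolding legal_words_def
proof (intro conjI ballI allI impI)
  show "triple_head ` W \<noteq> {}" using assms by (simp add: legal_words_def)
next
  fix y assume "y \<in> triple_head ` W"
  then obtain x where x: "x \<in> W" "y = triple_head x" by auto
  then have len: "length x = 2 * n" and "runs_ok x" "map Not x \<in> W"
    using assms by (auto simp: legal_words_def)
  then show "length y = 2 * (n + 3)" "runs_ok y" using assms(2) x by (auto intro: runs_ok_triple_head)
  have "map Not y = triple_head (map Not x)" by (simp add: x triple_head_def take_map)
  then show "map Not y \<in> triple_head ` W" using \<open>map Not x \<in> W\<close> by simp
next
  fix j assume j: "j < 2 * (n + 3)"
  define i where "i = (if j < 6 then j mod 3 else j - 6)"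
  have "i < 2 * n" using j assms(2) by (auto simp: i_def intro: less_le_trans[of _ 3])
  then have "\<exists>d. length d = 2 * n \<and> peak d i \<and> (\<forall>x\<in>W. flip d x \<in> W)"
    using assms(1) unfolding legal_words_def by blast
  then obtain d where d: "length d = 2 * n" "peak d i" "\<forall>x\<in>W. flip d x \<in> W"
    by blast
  have "flip (triple_head d) (triple_head x) = triple_head (flip d x)" if "x \<in> W" for x
    using that assms d(1) by (simp add: triple_head_def flip_def legal_words_def take_map take_zip)
  then show "\<exists>d. length d = 2 * (n + 3) \<and> peak d j \<and> (\<forall>x\<in>triple_head ` W. flip d x \<in> triple_head ` W)"
    using d j assms(2) by (intro exI[of _ "triple_head d"]) (auto simp: i_def intro!: peak_triple_head)
qed

section \<open>Words for the degrees five, six and seven\<close>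

definition bits :: "nat list \<Rightarrow> bool list" where
  "bits = map (\<lambda>k. k = 1)"

lemma legal_wordsI:
  assumes "W \<noteq> {}"
    and "\<And>x. x \<in> W \<Longrightarrow> length x = 2 * n \<and> runs_ok x \<and> map Not x \<in> W"
    and "\<And>j. j < 2 * n \<Longrightarrow> \<exists>d\<in>D. peak d j"
    and "\<And>d. d \<in> D \<Longrightarrow> length d = 2 * n \<and> (\<forall>x\<in>W. flip d x \<in> W)"
  shows "legal_words n W"
  unfolding legal_words_def using assms(1,2,4) assms(3)[unfolded Bex_def]
  by (intro conjI ballI allI impI) metis+

text \<open>
  Three parameters with period three do not suffice, because the first and the last of ten
  positions would depend on the same one although they are adjacent. The parameter \<open>h\<close> repairs
  this. In the positions \<open>0, 3, 4, 7\<close> that depend on \<open>a\<close>, flipping \<open>a\<close> alone is a move at 0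
  and 7 only, since 3 and 4 are adjacent; flipping \<open>a\<close> and \<open>h\<close> is a move at 3, and flipping
  \<open>h\<close> is one at 4.
\<close>

definition word5 :: "bool \<Rightarrow> bool \<Rightarrow> bool \<Rightarrow> bool \<Rightarrow> bool list" where
  "word5 a b c h = [a, b, c, a, a \<noteq> h, \<not> b, \<not> c, a \<noteq> h, b = h, c \<noteq> h]"

lemma legal_words5: "legal_words 5 {word5 a b c h | a b c h. True}" (is "legal_words _ ?W")
proof (rule legal_wordsI)
  let ?D = "map bits [
    [1,0,0,1,1,0,0,1,0,0],
    [0,1,0,0,0,1,0,0,1,0],
    [0,0,1,0,0,0,1,0,0,1],
    [0,0,0,0,1,0,0,1,1,1],
    [1,0,0,1,0,0,0,0,1,1]]"
  have mem: "word5 a b c h \<in> ?W" for a b c h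
    by blast
  have flips:
    "flip (bits [1,0,0,1,1,0,0,1,0,0]) (word5 a b c h) = word5 (\<not> a) b c h"
    "flip (bits [0,1,0,0,0,1,0,0,1,0]) (word5 a b c h) = word5 a (\<not> b) c h"
    "flip (bits [0,0,1,0,0,0,1,0,0,1]) (word5 a b c h) = word5 a b (\<not> c) h"
    "flip (bits [0,0,0,0,1,0,0,1,1,1]) (word5 a b c h) = word5 a b c (\<not> h)"
    "flip (bits [1,0,0,1,0,0,0,0,1,1]) (word5 a b c h) = word5 (\<not> a) b c (\<not> h)" for a b c h
    by (auto simp: flip_def bits_def word5_def)
  have len: "length (word5 a b c h) = 2 * 5" for a b c h
    by (simp add: word5_def)
  have compl: "map Not (word5 a b c h) = word5 (\<not> a) (\<not> b) (\<not> c) h" for a b c h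
    by (auto simp: word5_def)
  have runs: "runs_ok (word5 a b c h)" for a b c h
    by (cases a; cases b; cases c; cases h; simp add: word5_def runs_ok_def Let_def)
  show "?W \<noteq> {}"
    using mem by blast
  show "length x = 2 * 5 \<and> runs_ok x \<and> map Not x \<in> ?W" if x: "x \<in> ?W" for x
  proof -
    obtain a b c h where "x = word5 a b c h"
      using x by blast
    then show ?thesis
      using len runs compl mem by simp
  qed
  show "\<exists>d\<in>set ?D. peak d j" if "j < 2 * 5" for j
  proof -
    have "list_all (\<lambda>j. list_ex (\<lambda>d. peak d j) ?D) [0..<2 * 5]"
      by code_simp
    then show ?thesis
      using that unfolding list_all_iff list_ex_iff by simp
  qed
  show "length d = 2 * 5 \<and> (\<forall>x\<in>?W. flip d x \<in> ?W)" if "d \<in> set ?D" for d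
  proof -
    have "length d = 2 * 5"
      using that by (auto simp: bits_def)
    moreover have "flip d (word5 a b c h) \<in> ?W" for a b c h
      using that mem flips by auto
    ultimately show ?thesis by blast
  qed
qed

text \<open>
  The three parameters are the colours of the proper colouring of period three. Cyclically, the
  letters three places apart are equal except for the positions 5 and 8 and the positions 11 and 2.
  Hence a run of length at least three begins two places before position 8 or 2 and ends just
  before position 8 or 2, so that its length is even.
\<close>

definition word6 :: "bool \<Rightarrow> bool \<Rightarrow> bool \<Rightarrow> bool list" where
  "word6 a b c = [a, b, c, a, b, c, a, b, \<not> c, a, b, \<not> c]"

lemma legal_words6: "legal_words 6 {word6 a b c | a b c. True}" (is "legal_words _ ?W")
proof (rule legal_wordsI)
  let ?D = "map bits [
    [1,0,0,1,0,0,1,0,0,1,0,0],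
    [0,1,0,0,1,0,0,1,0,0,1,0],
    [0,0,1,0,0,1,0,0,1,0,0,1]]"
  have mem: "word6 a b c \<in> ?W" for a b c
    by blast
  have flips:
    "flip (bits [1,0,0,1,0,0,1,0,0,1,0,0]) (word6 a b c) = word6 (\<not> a) b c"
    "flip (bits [0,1,0,0,1,0,0,1,0,0,1,0]) (word6 a b c) = word6 a (\<not> b) c"
    "flip (bits [0,0,1,0,0,1,0,0,1,0,0,1]) (word6 a b c) = word6 a b (\<not> c)" for a b c
    by (auto simp: flip_def bits_def word6_def)
  have len: "length (word6 a b c) = 2 * 6" for a b c
    by (simp add: word6_def)
  have compl: "map Not (word6 a b c) = word6 (\<not> a) (\<not> b) (\<not> c)" for a b c
    by (auto simp: word6_def)
  have runs: "runs_ok (word6 a b c)" for a b c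
    by (cases a; cases b; cases c; simp add: word6_def runs_ok_def Let_def)
  show "?W \<noteq> {}"
    using mem by blast
  show "length x = 2 * 6 \<and> runs_ok x \<and> map Not x \<in> ?W" if x: "x \<in> ?W" for x
  proof -
    obtain a b c where "x = word6 a b c"
      using x by blast
    then show ?thesis
      using len runs compl mem by simp
  qed
  show "\<exists>d\<in>set ?D. peak d j" if "j < 2 * 6" for j
  proof -
    have "list_all (\<lambda>j. list_ex (\<lambda>d. peak d j) ?D) [0..<2 * 6]"
      by code_simp
    then show ?thesis
      using that unfolding list_all_iff list_ex_iff by simp
  qed
  show "length d = 2 * 6 \<and> (\<forall>x\<in>?W. flip d x \<in> ?W)" if "d \<in> set ?D" for d
  proof -
    have "length d = 2 * 6"
      using that by (auto simp: bits_def)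
    moreover have "flip d (word6 a b c) \<in> ?W" for a b c
      using that mem flips by auto
    ultimately show ?thesis by blast
  qed
qed

text \<open>
  Since 14 is not a multiple of three, two blocks of the colouring use the fourth colour \<open>h\<close>.
  As for \<open>word5\<close>, no uniform reason is given for the lengths of the runs; they are checked for all
  values of the parameters.
\<close>

definition word7 :: "bool \<Rightarrow> bool \<Rightarrow> bool \<Rightarrow> bool \<Rightarrow> bool list" where
  "word7 a b c h = [a, b, c, a, b, c, a, b, c, h, \<not> a, \<not> b, \<not> c, \<not> h]"

lemma legal_words7: "legal_words 7 {word7 a b c h | a b c h. True}" (is "legal_words _ ?W")
proof (rule legal_wordsI)
  let ?D = "map bits [
    [1,0,0,1,0,0,1,0,0,0,1,0,0,0],
    [0,1,0,0,1,0,0,1,0,0,0,1,0,0],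
    [0,0,1,0,0,1,0,0,1,0,0,0,1,0],
    [0,0,0,0,0,0,0,0,0,1,0,0,0,1]]"
  have mem: "word7 a b c h \<in> ?W" for a b c h
    by blast
  have flips:
    "flip (bits [1,0,0,1,0,0,1,0,0,0,1,0,0,0]) (word7 a b c h) = word7 (\<not> a) b c h"
    "flip (bits [0,1,0,0,1,0,0,1,0,0,0,1,0,0]) (word7 a b c h) = word7 a (\<not> b) c h"
    "flip (bits [0,0,1,0,0,1,0,0,1,0,0,0,1,0]) (word7 a b c h) = word7 a b (\<not> c) h"
    "flip (bits [0,0,0,0,0,0,0,0,0,1,0,0,0,1]) (word7 a b c h) = word7 a b c (\<not> h)" for a b c h
    by (auto simp: flip_def bits_def word7_def)
  have len: "length (word7 a b c h) = 2 * 7" for a b c h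
    by (simp add: word7_def)
  have compl: "map Not (word7 a b c h) = word7 (\<not> a) (\<not> b) (\<not> c) (\<not> h)" for a b c h
    by (auto simp: word7_def)
  have runs: "runs_ok (word7 a b c h)" for a b c h
    by (cases a; cases b; cases c; cases h; simp add: word7_def runs_ok_def Let_def)
  show "?W \<noteq> {}"
    using mem by blast
  show "length x = 2 * 7 \<and> runs_ok x \<and> map Not x \<in> ?W" if x: "x \<in> ?W" for x
  proof -
    obtain a b c h where "x = word7 a b c h"
      using x by blast
    then show ?thesis
      using len runs compl mem by simp
  qed
  show "\<exists>d\<in>set ?D. peak d j" if "j < 2 * 7" for j
  proof -
    have "list_all (\<lambda>j. list_ex (\<lambda>d. peak d j) ?D) [0..<2 * 7]"
      by code_simp
    then show ?thesis
      using that unfolding list_all_iff list_ex_iff by simp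
  qed
  show "length d = 2 * 7 \<and> (\<forall>x\<in>?W. flip d x \<in> ?W)" if "d \<in> set ?D" for d
  proof -
    have "length d = 2 * 7"
      using that by (auto simp: bits_def)
    moreover have "flip d (word7 a b c h) \<in> ?W" for a b c h
      using that mem flips by auto
    ultimately show ?thesis by blast
  qed
qed

lemma ex_legal_words:
  assumes "n \<ge> 5"
  shows "\<exists>W. legal_words n W"
  using assms
proof (induction n rule: less_induct)
  case (less n)
  show ?case
  proof (cases "n \<ge> 8")
    case True
    then have "n - 3 < n" "n - 3 \<ge> 5" by simp_all
    then obtain W where "legal_words (n - 3) W" using less.IH by blast
    then have "legal_words (n - 3 + 3) (triple_head ` W)"
      using True by (intro legal_words_triple_head) auto
    then show ?thesis using True by auto
  next
    case False
    then have "n = 5 \<or> n = 6 \<or> n = 7" using less.prems by auto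
    then show ?thesis using legal_words5 legal_words6 legal_words7 by blast
  qed
qed

section \<open>The zigzag through the vertices of the antiprism\<close>

text \<open>
  The even positions run through one \<open>n\<close>-gon and the odd ones through the other, and the position
  matters only modulo \<open>2 * n\<close>.
\<close>

definition zigzag :: "nat \<Rightarrow> nat \<Rightarrow> loebell_vertex" where
  "zigzag n i = Ring (odd i) (i div 2 mod n)"

definition position :: "bool \<Rightarrow> nat \<Rightarrow> nat" where
  "position b k = 2 * k + of_bool b"

lemma position_less: "k < n \<Longrightarrow> position b k < 2 * n"
  by (cases b) (auto simp: position_def)

lemma position_eq_mod: "position (odd i) (i div 2 mod n) = i mod (2 * n)"
  by (simp add: position_def mod_mult2_eq mod2_eq_if)

lemma zigzag_position: "k < n \<Longrightarrow> zigzag n (position b k) = Ring b k"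
  by (cases b) (simp_all add: zigzag_def position_def)

lemma zigzag_eq_iff: "zigzag n i = zigzag n j \<longleftrightarrow> i mod (2 * n) = j mod (2 * n)"
proof
  assume "zigzag n i = zigzag n j"
  then show "i mod (2 * n) = j mod (2 * n)"
    unfolding position_eq_mod[symmetric] zigzag_def by simp
next
  assume *: "i mod (2 * n) = j mod (2 * n)"
  then have "odd i = odd j" by (metis dvd_mod_iff dvd_triv_left)
  moreover have "i mod (2 * n) div 2 = j mod (2 * n) div 2"
    using * by simp
  then have "i div 2 mod n = j div 2 mod n"
    by (simp add: mod_mult2_eq)
  ultimately show "zigzag n i = zigzag n j"
    by (simp add: zigzag_def)
qed

lemma sym_parcs_dual_loebell_graph: "sym (parcs (dual_loebell_graph n))"
  by (auto simp: dual_loebell_graph_def sym_def)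

lemma zigzag_adjacent:
  assumes "n \<ge> 2"
  shows "(zigzag n i, zigzag n (i + 1)) \<in> parcs (dual_loebell_graph n)"
    and "(zigzag n i, zigzag n (i + 2)) \<in> parcs (dual_loebell_graph n)"
    and "(zigzag n i, Apex (odd i)) \<in> parcs (dual_loebell_graph n)"
proof -
  define k where "k = i div 2 mod n"
  have k: "k < n" "Suc (i div 2) mod n = Suc k mod n"
    using assms by (auto simp: k_def mod_Suc_eq)
  note E = parcs_dual_loebell_graph[OF assms] symcl_def
  show "(zigzag n i, zigzag n (i + 1)) \<in> parcs (dual_loebell_graph n)"
    unfolding E using k by (cases "odd i") (force simp: zigzag_def k_def[symmetric] image_iff)+
  show "(zigzag n i, zigzag n (i + 2)) \<in> parcs (dual_loebell_graph n)"
    unfolding E using k by (force simp: zigzag_def k_def[symmetric])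
  show "(zigzag n i, Apex (odd i)) \<in> parcs (dual_loebell_graph n)"
    unfolding E using k by (force simp: zigzag_def k_def[symmetric])
qed

text \<open>
  Conversely, edges between vertices of the antiprism join positions one or two steps apart. This
  is what makes peaks into moves.
\<close>

lemma ring_adjacentE:
  assumes "n \<ge> 2" "(Ring b k, Ring b' k') \<in> parcs (dual_loebell_graph n)"
  obtains i t where "t \<in> {1, 2}" "{Ring b k, Ring b' k'} = {zigzag n i, zigzag n (i + t)}"
proof -
  define R where "R = {(Ring b i, Ring b (Suc i mod n)) | b i. i < n} \<union>
      {(Ring False i, Ring True i) | i. i < n} \<union>
      {(Ring False (Suc i mod n), Ring True i) | i. i < n} \<union>
      {(Apex b, Ring b i) | b i. i < n}"
  have same: "Ring b i = zigzag n (position b i)"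
    "Ring b (Suc i mod n) = zigzag n (position b i + 2)" if "i < n" for b i
    using that by (cases b; simp add: zigzag_def position_def)+
  have other: "Ring True i = zigzag n (2 * i + 1)" "Ring False i = zigzag n (2 * i)"
    "Ring False (Suc i mod n) = zigzag n (2 * i + 1 + 1)" if "i < n" for i
    using that by (simp_all add: zigzag_def)
  have key: "\<exists>i t. t \<in> {1, 2} \<and> {p, q} = {zigzag n i, zigzag n (i + t)}"
    if "(p, q) \<in> R" "p \<noteq> Apex True" "p \<noteq> Apex False" for p q
    using that(1) unfolding R_def
  proof (elim UnE CollectE exE conjE)
    fix c i assume "(p, q) = (Ring c i, Ring c (Suc i mod n))" "i < n"
    then show ?thesis using same[of i c]
      by (intro exI[of _ "position c i"] exI[of _ 2]) simp
  next
    fix i assume "(p, q) = (Ring False i, Ring True i)" "i < n"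
    then show ?thesis using other[of i] by (intro exI[of _ "2 * i"] exI[of _ 1]) simp
  next
    fix i assume "(p, q) = (Ring False (Suc i mod n), Ring True i)" "i < n"
    then show ?thesis using other[of i]
      by (intro exI[of _ "2 * i + 1"] exI[of _ 1]) (simp add: insert_commute)
  next
    fix c i assume "(p, q) = (Apex c, Ring c i)"
    then show ?thesis using that(2,3) by (cases c) auto
  qed
  have "parcs (dual_loebell_graph n) = symcl R"
    unfolding R_def by (rule parcs_dual_loebell_graph[OF assms(1)])
  then have "(Ring b k, Ring b' k') \<in> R \<or> (Ring b' k', Ring b k) \<in> R"
    using assms(2) by (force simp: symcl_def)
  then show ?thesis
    using key[of "Ring b k" "Ring b' k'"] key[of "Ring b' k'" "Ring b k"] that
    by (auto simp: insert_commute)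
qed

section \<open>From words to states\<close>

text \<open>
  The state contains \<open>Apex a\<close> and not the other apex, and the letters of \<open>x\<close> tell which vertices
  are in the same state as their own apex. With this reading a state and its complement have the
  same word, and connectivity has to be shown for one of them only.
\<close>

definition word_state :: "nat \<Rightarrow> bool \<Rightarrow> bool list \<Rightarrow> loebell_vertex set" where
  "word_state n a x =
     insert (Apex a) {Ring b k | b k. k < n \<and> x ! (position b k) = (b = a)}"

definition ring_move :: "nat \<Rightarrow> bool list \<Rightarrow> loebell_vertex set" where
  "ring_move n d = {Ring b k | b k. k < n \<and> d ! (position b k)}"

lemma in_word_state [simp]:
  "Apex c \<in> word_state n a x \<longleftrightarrow> c = a"
  "Ring b k \<in> word_state n a x \<longleftrightarrow> k < n \<and> x ! (position b k) = (b = a)"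
  by (auto simp: word_state_def)

lemma in_ring_move [simp]:
  "Apex c \<notin> ring_move n d"
  "Ring b k \<in> ring_move n d \<longleftrightarrow> k < n \<and> d ! (position b k)"
  by (auto simp: ring_move_def)

lemma zigzag_in_word_state:
  assumes "n > 0" "length x = 2 * n"
  shows "zigzag n i \<in> word_state n a x \<longleftrightarrow> cyc x i = (odd i = a)"
  using assms by (simp add: zigzag_def cyc_def position_eq_mod)

lemma compl_word_state:
  assumes "n > 0"
  shows "pverts (dual_loebell_graph n) - word_state n a x = word_state n (\<not> a) x"
proof (rule Set.set_eqI)
  fix v
  show "v \<in> pverts (dual_loebell_graph n) - word_state n a x \<longleftrightarrow> v \<in> word_state n (\<not> a) x"
    using assms by (cases v) (auto simp: pverts_dual_loebell_graph)
qed

lemma sym_diff_ring_move: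
  assumes "length x = 2 * n" "length d = 2 * n"
  shows "sym_diff (ring_move n d) (word_state n a x) = word_state n a (flip d x)"
proof -
  have "flip d x ! (position b k) = (d ! (position b k) \<noteq> x ! (position b k))"
    if "k < n" for k b
    using position_less[OF that] assms by (simp add: flip_def)
  then have "v \<in> sym_diff (ring_move n d) (word_state n a x) \<longleftrightarrow> v \<in> word_state n a (flip d x)"
    for v by (cases v) auto
  then show ?thesis by blast
qed

lemma sym_diff_apices:
  assumes "length x = 2 * n"
  shows "sym_diff (range Apex) (word_state n a x) = word_state n (\<not> a) (map Not x)"
proof -
  have "map Not x ! (position b k) = (\<not> x ! (position b k))" if "k < n" for k b
    using position_less[OF that] assms by simp
  then have "v \<in> sym_diff (range Apex) (word_state n a x) \<longleftrightarrow>
      v \<in> word_state n (\<not> a) (map Not x)" for v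
    by (cases v) auto
  then show ?thesis by blast
qed

text \<open>
  Every vertex of the state reaches \<open>Apex a\<close>: in one step if its letter is \<open>True\<close>, and otherwise by
  steps of two through its run up to the neighbour of the end at odd distance, then by a step to
  this end, which is adjacent to \<open>Apex a\<close>.
\<close>

lemma connected_word_state:
  assumes n: "n \<ge> 2" and x: "length x = 2 * n" "runs_ok x"
  shows "Digraph_Component.connected (with_proj (dual_loebell_graph n) \<restriction> word_state n a x)"
proof (rule connected_if_all_reach)
  define S where "S = word_state n a x"
  define E where "E = Restr (parcs (dual_loebell_graph n)) S"
  show a: "Apex a \<in> word_state n a x" by (simp add: word_state_def)
  have "sym E" using sym_parcs_dual_loebell_graph[of n] by (auto simp: E_def sym_def)
  note sym = symD[OF sym_rtrancl[OF this]]
  have in_S: "zigzag n i \<in> S \<longleftrightarrow> cyc x i = (odd i = a)" for i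
    unfolding S_def using n x by (intro zigzag_in_word_state) simp_all
  have adj: "(zigzag n i, zigzag n (i + t)) \<in> E\<^sup>*"
    if "zigzag n i \<in> S" "zigzag n (i + t) \<in> S" "t = 1 \<or> t = 2" for i t
    using that zigzag_adjacent[OF n, of i] by (auto simp: E_def)
  have one: "(zigzag n i, Apex a) \<in> E\<^sup>*" if "cyc x i" "odd i = a" for i
    using zigzag_adjacent(3)[OF n, of i] that a in_S[of i] by (auto simp: E_def S_def)
  have walk: "(zigzag n i, zigzag n (i + 2 * s)) \<in> E\<^sup>*"
    if "odd i \<noteq> a" "\<And>t. t \<le> 2 * s \<Longrightarrow> \<not> cyc x (i + t)" for i s
    using that
  proof (induction s)
    case (Suc s)
    have "(zigzag n (i + 2 * s), zigzag n (i + 2 * s + 2)) \<in> E\<^sup>*"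
      using Suc.prems(1) Suc.prems(2)[of "2 * s"] Suc.prems(2)[of "2 * s + 2"]
      by (intro adj) (auto simp: in_S add.assoc)
    with Suc.IH[OF Suc.prems(1)] Suc.prems(2) show ?case by (auto intro: rtrancl_trans)
  qed simp
  have zz: "(zigzag n i, Apex a) \<in> E\<^sup>*" if i: "zigzag n i \<in> S" for i
  proof (cases "cyc x i")
    case True
    then show ?thesis using i in_S[of i] by (intro one) auto
  next
    case False
    then have odd: "odd i \<noteq> a" using i in_S by auto
    obtain r where "odd r" and r: "cyc x (i + r) \<and> (\<forall>t<r. \<not> cyc x (i + t)) \<or>
      (\<exists>i'. (i' + r) mod (2 * n) = i mod (2 * n) \<and> cyc x i' \<and>
         (\<forall>t. 1 \<le> t \<and> t \<le> r \<longrightarrow> \<not> cyc x (i' + t)))"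
      using odd_run_end[OF x(2) False] x(1) by auto
    then obtain s where s: "r = 2 * s + 1" by (elim oddE)
    from r show ?thesis
    proof (elim disjE conjE exE)
      assume R: "cyc x (i + r)" "\<forall>t<r. \<not> cyc x (i + t)"
      have "(zigzag n i, zigzag n (i + 2 * s)) \<in> E\<^sup>*" using R odd s by (intro walk) auto
      moreover have "(zigzag n (i + 2 * s), zigzag n (i + 2 * s + 1)) \<in> E\<^sup>*"
        using R odd s by (intro adj) (auto simp: in_S)
      moreover have "(zigzag n (i + 2 * s + 1), Apex a) \<in> E\<^sup>*"
        using R odd s by (intro one) auto
      ultimately show ?thesis by (meson rtrancl_trans)
    next
      fix i' assume L: "(i' + r) mod (2 * n) = i mod (2 * n)" "cyc x i'"
        "\<forall>t. 1 \<le> t \<and> t \<le> r \<longrightarrow> \<not> cyc x (i' + t)"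
      have eq: "zigzag n i = zigzag n (i' + 1 + 2 * s)"
        using L(1) s by (simp add: zigzag_eq_iff add_ac)
      then have "odd i = odd (i' + 1 + 2 * s)" by (simp add: zigzag_def)
      then have odd': "odd i' = a" using odd by auto
      have "(zigzag n (i' + 1), zigzag n (i' + 1 + 2 * s)) \<in> E\<^sup>*"
      proof (rule walk)
        show "odd (i' + 1) \<noteq> a" using odd' by simp
        show "\<not> cyc x (i' + 1 + t)" if "t \<le> 2 * s" for t
          using L(3)[rule_format, of "1 + t"] that s by (simp add: add.assoc)
      qed
      moreover have "(zigzag n i', zigzag n (i' + 1)) \<in> E\<^sup>*"
        using L(2) L(3)[rule_format, of 1] odd' s by (intro adj) (auto simp: in_S)
      moreover have "(zigzag n i', Apex a) \<in> E\<^sup>*" using L odd' by (intro one) auto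
      ultimately show ?thesis unfolding eq by (meson rtrancl_trans sym)
    qed
  qed
  fix v assume v: "v \<in> word_state n a x"
  then consider "v = Apex a" | b k where "v = Ring b k" "k < n" by (auto simp: word_state_def)
  then have "(v, Apex a) \<in> E\<^sup>*"
  proof cases
    case (2 b k)
    then show ?thesis using zz[of "position b k"] v by (simp add: zigzag_position S_def)
  qed simp
  then show "(v, Apex a) \<in> (Restr (parcs (dual_loebell_graph n)) (word_state n a x))\<^sup>*"
    by (simp add: E_def S_def)
qed

lemma legal_word_state:
  assumes "n \<ge> 2" "length x = 2 * n" "runs_ok x"
  shows "legal_state (dual_loebell_graph n) (word_state n a x)"
proof -
  have "word_state n a x \<subseteq> pverts (dual_loebell_graph n)"
    using assms(1) by (auto simp: pverts_dual_loebell_graph word_state_def)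
  moreover have "word_state n c x \<noteq> {}" for c by (simp add: word_state_def)
  ultimately show ?thesis
    using assms by (simp add: legal_state_def is_state_def compl_word_state connected_word_state)
qed

lemma is_move_apices: "n \<ge> 2 \<Longrightarrow> is_move (dual_loebell_graph n) (Apex a) (range Apex)"
  by (auto simp: is_move_def pverts_dual_loebell_graph parcs_dual_loebell_graph symcl_def)

lemma near_mod:
  assumes "0 < t" "t \<le> 2" "2 < N"
  shows "near N (i mod N) ((i + t) mod N)"
proof -
  define j where "j = i mod N"
  have j: "j < N" "(i + t) mod N = (j + t) mod N" using assms by (auto simp: j_def mod_add_left_eq)
  then show ?thesis
    using assms unfolding j_def[symmetric]
    by (cases "j + t < N") (auto simp: near_def le_mod_geq)
qed

lemma near_commute: "near N i j \<longleftrightarrow> near N j i"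
  by (auto simp: near_def)

lemma is_move_ring_move:
  assumes n: "n \<ge> 2" and d: "length d = 2 * n" and k: "k < n"
    and peak: "peak d (position b k)"
  shows "is_move (dual_loebell_graph n) (Ring b k) (ring_move n d)"
  unfolding is_move_def
proof (intro conjI allI impI)
  show "ring_move n d \<subseteq> pverts (dual_loebell_graph n)"
    using n by (auto simp: ring_move_def pverts_dual_loebell_graph)
  show "Ring b k \<in> ring_move n d" using k peak by (auto simp: ring_move_def peak_def)
  fix u assume u: "(u, Ring b k) \<in> parcs (dual_loebell_graph n)"
  show "u \<notin> ring_move n d"
  proof
    assume ud: "u \<in> ring_move n d"
    then obtain b' k' where u': "u = Ring b' k'" "k' < n" by (auto simp: ring_move_def)
    define j where "j = position b k"
    define j' where "j' = position b' k'"
    have j: "j < 2 * n" "j' < 2 * n" "zigzag n j = Ring b k" "zigzag n j' = u"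
      using position_less k u' zigzag_position by (simp_all add: j_def j'_def)
    obtain i t where it: "t \<in> {1, 2}" "{u, Ring b k} = {zigzag n i, zigzag n (i + t)}"
      using ring_adjacentE[OF n] u u' by metis
    have "near (2 * n) (i mod (2 * n)) ((i + t) mod (2 * n))"
      using it n by (intro near_mod) auto
    moreover have "{j, j'} = {i mod (2 * n), (i + t) mod (2 * n)}"
    proof -
      have "u = zigzag n i \<and> Ring b k = zigzag n (i + t) \<or>
        u = zigzag n (i + t) \<and> Ring b k = zigzag n i"
        using it(2) by (auto simp: doubleton_eq_iff)
      then show ?thesis using j zigzag_eq_iff[of n j] zigzag_eq_iff[of n j'] by auto
    qed
    ultimately have "near (2 * n) j' j" by (auto simp: doubleton_eq_iff near_commute)
    moreover have "d ! j'" using ud u' by (auto simp: ring_move_def j'_def)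
    ultimately show False using peak j d by (auto simp: peak_def j_def)
  qed
qed

lemma has_legal_system_if_legal_words:
  assumes n: "n \<ge> 2" and W: "legal_words n W"
  shows "has_legal_system (dual_loebell_graph n)"
proof -
  let ?G = "dual_loebell_graph n"
  have "\<exists>d. length d = 2 * n \<and> (j < 2 * n \<longrightarrow> peak d j \<and> (\<forall>x\<in>W. flip d x \<in> W))" for j
    using W unfolding legal_words_def by (cases "j < 2 * n") (blast, metis length_replicate)
  then obtain d where d: "length (d j) = 2 * n"
    "j < 2 * n \<Longrightarrow> peak (d j) j \<and> (\<forall>x\<in>W. flip (d j) x \<in> W)" for j
    by metis
  define m where "m v = (case v of Apex _ \<Rightarrow> range Apex
    | Ring b k \<Rightarrow> ring_move n (d (position b k)))" for v
  define F where "F = {word_state n a x | a x. x \<in> W}"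
  have word: "length x = 2 * n" "runs_ok x" "map Not x \<in> W" if "x \<in> W" for x
    using that W by (auto simp: legal_words_def)
  have verts: "pverts ?G = range Apex \<union> {Ring b k | b k. k < n}"
    using n by (simp add: pverts_dual_loebell_graph)
  obtain x where x: "x \<in> W" using W by (auto simp: legal_words_def)
  have "legal_system ?G m"
  proof (rule legal_systemI)
    have "peak (d (position b k)) (position b k)" if "k < n" for b k
      using d(2)[OF position_less[OF that]] by blast
    then have "is_move ?G (Ring b k) (ring_move n (d (position b k)))" if "k < n" for b k
      using is_move_ring_move[OF n d(1) that] that by blast
    then show "system_of_moves ?G m"
      unfolding system_of_moves_def verts m_def
      using is_move_apices[OF n] by auto
    show "word_state n True x \<in> F" using x by (auto simp: F_def)
    show "legal_state ?G S" if "S \<in> F" for S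
      using that n word by (auto simp: F_def intro: legal_word_state)
    fix v S assume v: "v \<in> pverts ?G" and "S \<in> F"
    then obtain a y where y: "y \<in> W" "S = word_state n a y" by (auto simp: F_def)
    consider c where "v = Apex c" | b k where "v = Ring b k" "k < n" using v verts by auto
    then show "sym_diff (m v) S \<in> F"
    proof cases
      case 1
      then have "sym_diff (m v) S = word_state n (\<not> a) (map Not y)"
        using sym_diff_apices[OF word(1)[OF y(1)]] y by (simp add: m_def)
      then show ?thesis using word(3)[OF y(1)] unfolding F_def by blast
    next
      case (2 b k)
      let ?d = "d (position b k)"
      have "sym_diff (m v) S = word_state n a (flip ?d y)"
        using sym_diff_ring_move[OF word(1)[OF y(1)] d(1)] y 2 by (simp add: m_def)
      moreover have "flip ?d y \<in> W" using d(2) position_less 2 y by blast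
      ultimately show ?thesis unfolding F_def by blast
    qed
  qed
  then show ?thesis by (auto simp: has_legal_system_def)
qed

theorem lemma5p6:
  fixes n :: nat
  assumes "n \<ge> 5"
  shows "has_legal_system (dual_loebell_graph n)"
proof -
  obtain W where "legal_words n W" using ex_legal_words[OF assms] by blast
  then show ?thesis using assms by (intro has_legal_system_if_legal_words) auto
qed

end
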